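(* Let $k\ge 2$ be an integer and let $\mathcal{L}_k$ be the set of irreducible prohibited patterns for $k$. There do not exist crucial permutations with respect to $\mathcal{L}_k$.
   Context: An $n$-permutation ($n\ge 1$) is a permutation of $\{1,\ldots,n\}$ written as a word $\pi_1\ldots\pi_n$. The pattern of a word of $m$ distinct integers is the unique $m$-permutation order-isomorphic to it. A permutation contains a pattern $\tau$ of length $m$ if some factor $\pi_i\pi_{i+1}\ldots\pi_{i+m-1}$ (consecutive letters) is order-isomorphic to $\tau$. A prohibited pattern (for $k$) is a permutation of the form $xX(x+1)$ or $(x+1)Xx$, where $x\geq 1$, $X$ is a word of length $|X|\ge k-1$, and $X$ is a permutation of $\{1,2,\ldots,|X|+2\}\setminus\{x,x+1\}$. Write a prohibited pattern as $aYb$, with $a$, $b$ its first and last elements and $Y$ a word. It is irreducible if the patterns of $Yb$ and of $aY$ are both uniquely $k$-determined permutations. $\mathcal{L}_k$ is the set of all irreducible prohibited patterns, of all lengths. Uniquely $k$-determined: let $\mathcal{P}_k$ be the graph whose nodes are all $k$-permutations, with an arc from $a_1\ldots a_k$ to $b_1\ldots b_k$ if and only if $a_2\ldots a_k$ and $b_1\ldots b_{k-1}$ have the same pattern. For $n\ge k$, to an $n$-permutation $\pi$ corresponds the path in $\mathcal{P}_k$ whose $i$-th node is the pattern of $\pi_i\ldots\pi_{i+k-1}$, $i=1,\ldots,n-k+1$; $\pi$ is uniquely $k$-determined if no other $n$-permutation has the same path. For $n<k$ every $n$-permutation is regarded as uniquely $k$-determined. A permutation is uniquely $k$-determined exactly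 when it contains no pattern from $\mathcal{L}_k$. Adjoining an element $y\in\{1,\ldots,n+1\}$ to the right of an $n$-permutation $\pi$ produces the $(n+1)$-permutation whose last letter is $y$ and whose first $n$ letters are obtained from $\pi$ by increasing by $1$ every letter that is $\ge y$. An $n$-permutation is crucial with respect to a set of prohibited patterns if it contains no pattern from the set, but for every $y\in\{1,\ldots,n+1\}$ adjoining $y$ to its right gives an $(n+1)$-permutation that contains a pattern from the set. (For $\mathcal{L}_k$: it is uniquely $k$-determined, but adjoining any element to its right gives a non-uniquely $k$-determined permutation.) *)

theory Defs
  imports "HOL-Combinatorics.Multiset_Permutations" "HOL-Library.Sublist"
begin

definition perms :: "nat \<Rightarrow> nat list set" where
  "perms n = permutations_of_set {1..n}"

definition order_isomorphic :: "nat list \<Rightarrow> nat list \<Rightarrow> bool" where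
  "order_isomorphic u v \<longleftrightarrow> length u = length v \<and>
     (\<forall>i<length u. \<forall>j<length u. u ! i < u ! j \<longleftrightarrow> v ! i < v ! j)"

definition pattern_of :: "nat list \<Rightarrow> nat list" where
  "pattern_of w = (THE p. p \<in> perms (length w) \<and> order_isomorphic p w)"

lemma order_isomorphic_trans:
  "order_isomorphic u v \<Longrightarrow> order_isomorphic v w \<Longrightarrow> order_isomorphic u w"
  by (auto simp: order_isomorphic_def)

lemma order_isomorphic_sym: "order_isomorphic u v \<Longrightarrow> order_isomorphic v u"
  by (auto simp: order_isomorphic_def)

lemma perms_nth_eq_card:
  assumes "p \<in> perms n" and "i < n"
  shows "p ! i = Suc (card {j. j < n \<and> p ! j < p ! i})"
proof -
  have d: "distinct p" and s: "set p = {1..n}"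
    using assms(1) by (auto simp: perms_def permutations_of_set_def)
  have l: "length p = n"
    using distinct_card[OF d] s by simp
  have pi: "1 \<le> p ! i" "p ! i \<le> n"
    using s nth_mem[of i p] l assms(2) by auto
  have "(\<lambda>j. p ! j) ` {j. j < n \<and> p ! j < p ! i} = {1..<p ! i}"
  proof
    show "(\<lambda>j. p ! j) ` {j. j < n \<and> p ! j < p ! i} \<subseteq> {1..<p ! i}"
      using s l nth_mem[of _ p] by fastforce
    show "{1..<p ! i} \<subseteq> (\<lambda>j. p ! j) ` {j. j < n \<and> p ! j < p ! i}"
    proof
      fix x assume x: "x \<in> {1..<p ! i}"
      then have "x \<in> set p" using s pi by auto
      then obtain j where "j < n" "p ! j = x" using l by (auto simp: in_set_conv_nth)
      then show "x \<in> (\<lambda>j. p ! j) ` {j. j < n \<and> p ! j < p ! i}" using x by auto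
    qed
  qed
  moreover have "inj_on (\<lambda>j. p ! j) {j. j < n \<and> p ! j < p ! i}"
    using d l by (auto simp: inj_on_def nth_eq_iff_index_eq)
  ultimately have "card {j. j < n \<and> p ! j < p ! i} = card {1..<p ! i}"
    by (metis card_image)
  then show ?thesis using pi by simp
qed

lemma perms_order_isomorphic_eq:
  assumes "p \<in> perms n" and "q \<in> perms n" and "order_isomorphic p q"
  shows "p = q"
proof (rule nth_equalityI)
  have l: "length p = n" "length q = n"
    using assms(1,2) by (auto simp: perms_def permutations_of_set_def dest: distinct_card)
  then show "length p = length q" by simp
  fix i assume "i < length p"
  then have i: "i < n" using l by simp
  have "{j. j < n \<and> p ! j < p ! i} = {j. j < n \<and> q ! j < q ! i}"
    using assms(3) i l by (auto simp: order_isomorphic_def)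
  then show "p ! i = q ! i"
    using perms_nth_eq_card[OF assms(1) i] perms_nth_eq_card[OF assms(2) i] by simp
qed

lemma pattern_of_ex1:
  assumes d: "distinct w"
  shows "\<exists>!p. p \<in> perms (length w) \<and> order_isomorphic p w"
proof (rule ex_ex1I)
  define r where "r a = card {b \<in> set w. b \<le> a}" for a
  have less: "r a < r b" if "a < b" "b \<in> set w" for a b
  proof -
    have "b \<in> {c \<in> set w. c \<le> b} - {c \<in> set w. c \<le> a}" using that by auto
    then have "{c \<in> set w. c \<le> a} \<subset> {c \<in> set w. c \<le> b}" using that by force
    then show ?thesis unfolding r_def by (intro psubset_card_mono) auto
  qed
  have iff: "r a < r b \<longleftrightarrow> a < b" if "a \<in> set w" "b \<in> set w" for a b
    using less[of a b] less[of b a] that by (cases a b rule: linorder_cases) auto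
  have inj: "inj_on r (set w)"
    by (metis iff inj_onI linorder_neq_iff)
  have "r ` set w = {1..length w}"
  proof (rule card_subset_eq)
    show "r ` set w \<subseteq> {1..length w}"
    proof
      fix x assume "x \<in> r ` set w"
      then obtain a where a: "a \<in> set w" "x = r a" by auto
      have "card {b \<in> set w. b \<le> a} > 0" using a by (subst card_gt_0_iff) auto
      moreover have "card {b \<in> set w. b \<le> a} \<le> card (set w)" by (rule card_mono) auto
      ultimately show "x \<in> {1..length w}" using a d by (simp add: r_def distinct_card del: card_gt_0_iff)
    qed
    show "card (r ` set w) = card {1..length w}"
      using inj d by (simp add: card_image distinct_card)
  qed simp
  then have "map r w \<in> perms (length w)"
    using d inj by (simp add: perms_def permutations_of_set_def distinct_map)
  moreover have "order_isomorphic (map r w) w"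
    using iff by (auto simp: order_isomorphic_def)
  ultimately show "\<exists>p. p \<in> perms (length w) \<and> order_isomorphic p w" by blast
next
  fix p q
  assume "p \<in> perms (length w) \<and> order_isomorphic p w"
    and "q \<in> perms (length w) \<and> order_isomorphic q w"
  then show "p = q"
    by (meson perms_order_isomorphic_eq order_isomorphic_trans order_isomorphic_sym)
qed

definition contains_pattern :: "nat list \<Rightarrow> nat list \<Rightarrow> bool" where
  "contains_pattern p t \<longleftrightarrow> (\<exists>u. sublist u p \<and> order_isomorphic u t)"

definition pattern_graph_arcs :: "nat \<Rightarrow> (nat list \<times> nat list) set" where
  "pattern_graph_arcs k =
     {(a, b). a \<in> perms k \<and> b \<in> perms k \<and> pattern_of (tl a) = pattern_of (butlast b)}"

text \<open>
  There is at most one arc from a node to another, so a path is given by its list of nodes.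
  The definition is meaningful for words of length at least \<open>k\<close>.
\<close>

definition pattern_path :: "nat \<Rightarrow> nat list \<Rightarrow> nat list list" where
  "pattern_path k p = map (\<lambda>i. pattern_of (take k (drop i p))) [0..<length p - k + 1]"

lemma pattern_of_props:
  assumes "distinct w"
  shows "pattern_of w \<in> perms (length w)" and "order_isomorphic (pattern_of w) w"
  using theI'[OF pattern_of_ex1[OF assms]] by (auto simp: pattern_of_def)

lemma pattern_of_cong:
  assumes "order_isomorphic u v"
  shows "pattern_of u = pattern_of v"
proof -
  have "length u = length v" using assms by (simp add: order_isomorphic_def)
  moreover have "order_isomorphic p u \<longleftrightarrow> order_isomorphic p v" for p
    using assms by (meson order_isomorphic_trans order_isomorphic_sym)
  ultimately show ?thesis by (simp add: pattern_of_def)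
qed

lemma order_isomorphic_tl: "order_isomorphic u v \<Longrightarrow> order_isomorphic (tl u) (tl v)"
  by (auto simp: order_isomorphic_def nth_tl)

lemma order_isomorphic_butlast:
  "order_isomorphic u v \<Longrightarrow> order_isomorphic (butlast u) (butlast v)"
  by (auto simp: order_isomorphic_def nth_butlast)

lemma pattern_path_successively:
  assumes "p \<in> perms n" and "1 \<le> k" and "k \<le> n"
  shows "successively (\<lambda>a b. (a, b) \<in> pattern_graph_arcs k) (pattern_path k p)"
proof -
  have d: "distinct p" and s: "set p = {1..n}"
    using assms(1) by (auto simp: perms_def permutations_of_set_def)
  have l: "length p = n" using distinct_card[OF d] s by simp
  have "(pattern_path k p ! i, pattern_path k p ! Suc i) \<in> pattern_graph_arcs k"
    if i: "Suc i < length (pattern_path k p)" for i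
  proof -
    let ?u = "take k (drop i p)" and ?v = "take k (drop (Suc i) p)"
    have ik: "i + k < n" using i l assms by (simp add: pattern_path_def)
    have "tl ?u = butlast ?v"
      using ik l assms(2) by (auto intro!: nth_equalityI simp: nth_tl nth_butlast)
    moreover have du: "distinct ?u" and dv: "distinct ?v" using d by auto
    moreover have "length ?u = k" "length ?v = k" using ik l by auto
    ultimately have "(pattern_of ?u, pattern_of ?v) \<in> pattern_graph_arcs k"
      using pattern_of_props[OF du] pattern_of_props[OF dv]
        pattern_of_cong[OF order_isomorphic_tl, of "pattern_of ?u" ?u]
        pattern_of_cong[OF order_isomorphic_butlast, of "pattern_of ?v" ?v]
      by (simp add: pattern_graph_arcs_def)
    moreover have "pattern_path k p ! i = pattern_of ?u" "pattern_path k p ! Suc i = pattern_of ?v"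
      using i by (auto simp: pattern_path_def simp del: upt_Suc)
    ultimately show ?thesis by simp
  qed
  then show ?thesis by (auto simp: successively_conv_nth)
qed

definition uniquely_determined :: "nat \<Rightarrow> nat list \<Rightarrow> bool" where
  "uniquely_determined k p \<longleftrightarrow> p \<in> perms (length p) \<and>
     (k \<le> length p \<longrightarrow>
       (\<forall>q \<in> perms (length p). pattern_path k q = pattern_path k p \<longrightarrow> q = p))"

definition prohibited_pattern :: "nat \<Rightarrow> nat list \<Rightarrow> bool" where
  "prohibited_pattern k p \<longleftrightarrow> p \<in> perms (length p) \<and>
     (\<exists>x X. 1 \<le> x \<and> k - 1 \<le> length X \<and>
        X \<in> permutations_of_set ({1..length X + 2} - {x, x + 1}) \<and>
        (p = x # X @ [x + 1] \<or> p = (x + 1) # X @ [x]))"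

definition irreducible_pattern :: "nat \<Rightarrow> nat list \<Rightarrow> bool" where
  "irreducible_pattern k p \<longleftrightarrow>
     (\<exists>a Y b. p = a # Y @ [b] \<and>
        uniquely_determined k (pattern_of (Y @ [b])) \<and>
        uniquely_determined k (pattern_of (a # Y)))"

definition irreducible_prohibited :: "nat \<Rightarrow> nat list set" where
  "irreducible_prohibited k = {p. prohibited_pattern k p \<and> irreducible_pattern k p}"

definition adjoin_right :: "nat \<Rightarrow> nat list \<Rightarrow> nat list" where
  "adjoin_right y p = map (\<lambda>a. if y \<le> a then a + 1 else a) p @ [y]"

definition crucial :: "nat list set \<Rightarrow> nat list \<Rightarrow> bool" where
  "crucial L p \<longleftrightarrow> 1 \<le> length p \<and> p \<in> perms (length p) \<and>
     (\<forall>t \<in> L. \<not> contains_pattern p t) \<and>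
     (\<forall>y \<in> {1..length p + 1}. \<exists>t \<in> L. contains_pattern (adjoin_right y p) t)"

end

theory Submission
  imports Defs "HOL-Combinatorics.Transposition"
begin

text \<open>
  Adjoin to a permutation with last letter \<open>c\<close> a letter immediately above or immediately below
  \<open>c\<close>. If this creates an irreducible prohibited pattern \<open>aYb\<close>, then \<open>b\<close> is the new letter and
  \<open>Y\<close> ends in \<open>c\<close>. Since \<open>b\<close> is a neighbour in value of both \<open>a\<close> and \<open>c\<close>, it lies between them,
  so \<open>a\<close> and \<open>c\<close> become neighbours in value once \<open>b\<close> is deleted. Unless \<open>aY\<close> has
  length \<open>k\<close>, exchanging \<open>a\<close> and \<open>c\<close> in \<open>aY\<close> preserves the path, contradicting irreducibility.
  Hence \<open>a\<close> is the \<open>k\<close>-th letter from the right. It would have to be greater than \<open>c\<close> when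
  adjoining above and smaller than \<open>c\<close> when adjoining below.
\<close>

text \<open>Phrased by comparisons alone, so that it passes to order-isomorphic words and applies to
  factors, whose letters need not be consecutive integers.\<close>

definition ends_adjacent :: "nat list \<Rightarrow> bool" where
  "ends_adjacent w \<longleftrightarrow>
     (\<forall>z\<in>set w. \<not> (hd w < z \<and> z < last w) \<and> \<not> (last w < z \<and> z < hd w))"

text \<open>Only letters fewer than \<open>k\<close> positions apart share a window, so the path
  records no other comparisons.\<close>

lemma pattern_path_cong:
  assumes "length u = length v"
    and "\<And>i j. i < length v \<Longrightarrow> j < length v \<Longrightarrow> i < j + k \<Longrightarrow> j < i + k
           \<Longrightarrow> u ! i < u ! j \<longleftrightarrow> v ! i < v ! j"
  shows "pattern_path k u = pattern_path k v"
proof -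
  have "pattern_of (take k (drop i u)) = pattern_of (take k (drop i v))" for i
    by (rule pattern_of_cong) (use assms in \<open>auto simp: order_isomorphic_def\<close>)
  then show ?thesis
    using assms(1) by (simp add: pattern_path_def)
qed

lemma pattern_path_order_isomorphic:
  "order_isomorphic u v \<Longrightarrow> pattern_path k u = pattern_path k v"
  by (rule pattern_path_cong) (auto simp: order_isomorphic_def)

lemma pattern_path_pattern_of:
  "distinct w \<Longrightarrow> pattern_path k (pattern_of w) = pattern_path k w"
  by (intro pattern_path_order_isomorphic pattern_of_props(2))

lemma perms_length: "p \<in> perms n \<Longrightarrow> length p = n"
  by (auto simp: perms_def permutations_of_set_def dest: distinct_card)

lemma perms_distinct: "p \<in> perms n \<Longrightarrow> distinct p"
  by (auto simp: perms_def permutations_of_set_def)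

lemma order_isomorphic_ends_adjacent:
  assumes "order_isomorphic u v" "ends_adjacent v" "u \<noteq> []"
  shows "ends_adjacent u"
proof -
  have l: "length u = length v" "v \<noteq> []"
    using assms by (auto simp: order_isomorphic_def)
  have "\<not> (v ! 0 < v ! i \<and> v ! i < v ! (length v - 1)) \<and>
        \<not> (v ! (length v - 1) < v ! i \<and> v ! i < v ! 0)" if "i < length v" for i
    using assms(2) l that nth_mem[OF that]
    by (simp add: ends_adjacent_def hd_conv_nth last_conv_nth)
  then show ?thesis
    using assms l by (auto simp: ends_adjacent_def hd_conv_nth last_conv_nth
        order_isomorphic_def in_set_conv_nth)
qed

text \<open>Exchanging two values with nothing between them affects only their comparison with each
  other.\<close>

lemma transpose_less_iff:
  fixes a b x y :: nat
  assumes "\<not> (a < x \<and> x < b)" "\<not> (b < x \<and> x < a)" "\<not> (a < y \<and> y < b)" "\<not> (b < y \<and> y < a)"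
    and "{x, y} \<noteq> {a, b}"
  shows "transpose a b x < transpose a b y \<longleftrightarrow> x < y"
  using assms unfolding transpose_def doubleton_eq_iff by presburger

text \<open>The end letters are at least \<open>k\<close> positions apart, so no window sees their
  exchange, which yields a second permutation with the same path.\<close>

lemma not_uniquely_determined_if_ends_adjacent:
  assumes d: "distinct w" and k: "1 \<le> k" "k < length w" and adj: "ends_adjacent w"
  shows "\<not> uniquely_determined k (pattern_of w)"
proof
  define v where "v = map (transpose (hd w) (last w)) w"
  assume u: "uniquely_determined k (pattern_of w)"
  have dv: "distinct v"
    using d by (auto simp: v_def distinct_map inj_on_def dest: transpose_eq_imp_eq)
  have lv: "length v = length w" by (simp add: v_def)
  have ne: "w \<noteq> []" using k by auto
  have ends: "hd w = w ! 0" "last w = w ! (length w - 1)"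
    using ne by (auto simp: hd_conv_nth last_conv_nth)
  have lt: "v ! i < v ! j \<longleftrightarrow> w ! i < w ! j"
    if i: "i < length w" "j < length w" "i < j + k" "j < i + k" for i j
  proof -
    have "{w ! i, w ! j} \<noteq> {hd w, last w}"
      using i k d ne unfolding ends by (auto simp: doubleton_eq_iff nth_eq_iff_index_eq)
    then show ?thesis
      using adj i unfolding v_def ends_adjacent_def
      by (simp, intro transpose_less_iff) auto
  qed
  have pv: "pattern_path k v = pattern_path k w"
    by (rule pattern_path_cong) (use lt lv in auto)
  have "pattern_of v \<in> perms (length (pattern_of w))" "k \<le> length (pattern_of w)"
    using pattern_of_props[OF dv] pattern_of_props[OF d] lv k by (auto dest: perms_length)
  then have "pattern_of v = pattern_of w"
    using u pv d dv by (simp add: uniquely_determined_def pattern_path_pattern_of)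
  then have "order_isomorphic v w"
    using pattern_of_props(2)[OF d] pattern_of_props(2)[OF dv]
    by (metis order_isomorphic_sym order_isomorphic_trans)
  \<comment> \<open>The exchange, however, reverses the comparison of the two ends.\<close>
  then have "v ! 0 < v ! (length w - 1) \<longleftrightarrow> w ! 0 < w ! (length w - 1)"
    using ne lv by (auto simp: order_isomorphic_def)
  moreover have "v ! 0 = w ! (length w - 1)" "v ! (length w - 1) = w ! 0"
    using ne by (auto simp: v_def ends)
  moreover have "w ! 0 \<noteq> w ! (length w - 1)"
    using d k ne by (auto simp: nth_eq_iff_index_eq)
  ultimately show False by linarith
qed

lemma prohibited_pattern_ends_adjacent:
  assumes "prohibited_pattern k t" "1 \<le> k"
  shows "ends_adjacent t" "k < length t"
  using assms by (auto simp: prohibited_pattern_def ends_adjacent_def)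

lemma irreducible_pattern_butlast:
  "irreducible_pattern k t \<Longrightarrow> uniquely_determined k (pattern_of (butlast t))"
  by (auto simp: irreducible_pattern_def simp flip: append_Cons)

text \<open>The relabelling is strictly increasing, so an occurrence that misses the new letter
  would already be present in \<open>p\<close>.\<close>

lemma sublist_adjoin_right:
  assumes "sublist u (adjoin_right y p)" "order_isomorphic u t" "\<not> contains_pattern p t"
  shows "suffix u (adjoin_right y p)"
proof (rule ccontr)
  let ?f = "\<lambda>a. if y \<le> a then a + 1 else a"
  assume "\<not> ?thesis"
  then have "sublist u (map ?f p)"
    using assms(1) unfolding adjoin_right_def sublist_snoc by blast
  then obtain v where v: "sublist v p" "u = map ?f v"
    using sublist_map_rightE by blast
  have "order_isomorphic v u"
    by (auto simp: v order_isomorphic_def)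
  then show False
    using v assms order_isomorphic_trans unfolding contains_pattern_def by blast
qed

lemma distinct_adjoin_right: "distinct p \<Longrightarrow> distinct (adjoin_right y p)"
  by (auto simp: adjoin_right_def distinct_map inj_on_def)

text \<open>The right side of the equivalence does not involve \<open>y\<close>, while the left side
  differs for the two values of \<open>y\<close>; this is what makes them incompatible.\<close>

lemma adjoin_next_to_last:
  assumes k: "2 \<le> k" and d: "distinct p" and ne: "p \<noteq> []"
    and t: "t \<in> irreducible_prohibited k"
    and avoid: "\<not> contains_pattern p t" and cont: "contains_pattern (adjoin_right y p) t"
    and y: "y = last p \<or> y = last p + 1"
  shows "y = last p + 1 \<longleftrightarrow> last p < p ! (length p - k)"
proof -
  let ?f = "\<lambda>a. if y \<le> a then a + 1 else a"
  \<comment> \<open>The old last letter after relabelling: \<open>y + 1\<close> if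
    \<open>y = last p\<close>, and \<open>y - 1\<close> if \<open>y = last p + 1\<close>.\<close>
  define c where "c = ?f (last p)"
  obtain u where u: "suffix u (adjoin_right y p)" "order_isomorphic u t"
    using cont avoid sublist_adjoin_right unfolding contains_pattern_def by blast
  have lu: "length u = length t" using u(2) by (simp add: order_isomorphic_def)
  have prt: "prohibited_pattern k t" and irt: "irreducible_pattern k t"
    using t by (auto simp: irreducible_prohibited_def)
  have lt: "k < length t" and adjt: "ends_adjacent t"
    using prohibited_pattern_ends_adjacent[OF prt] k by auto
  have du: "distinct u"
    using u(1) distinct_adjoin_right[OF d] by (metis distinct_append suffixE)
  have une: "u \<noteq> []" using lt lu by auto
  have adju: "ends_adjacent u"
    using order_isomorphic_ends_adjacent[OF u(2) adjt une] .
  obtain r where r: "map ?f p @ [y] = r @ u"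
    using u(1) by (auto simp: suffix_def adjoin_right_def)
  define w where "w = butlast u"
  have "map ?f p @ [y] = (r @ w) @ [last u]"
    using r une by (simp add: w_def)
  then have lastu: "last u = y" and rw: "map ?f p = r @ w" by auto
  have uw: "u = w @ [y]" using une lastu by (metis append_butlast_last_id w_def)
  have lw: "k \<le> length w" using lt lu by (simp add: w_def)
  then have wne: "w \<noteq> []" using k by auto
  have lastw: "last w = c"
    using arg_cong[OF rw, of last] ne wne by (simp add: c_def last_map)
  \<comment> \<open>Since \<open>k\<close> is at least 2, \<open>w\<close> has at least two
    letters.\<close>
  have hd: "hd w \<noteq> last w"
    using du lw k uw by (cases w) auto
  have cw: "c \<in> set w" using lastw wne last_in_set by metis
  have adj: "\<not> (hd w < z \<and> z < y)" "\<not> (y < z \<and> z < hd w)" if "z \<in> set w" for z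
    using adju that wne by (auto simp: ends_adjacent_def uw)
  have yw: "y \<notin> set w" using du uw by simp
  have cy: "y = last p \<and> c = y + 1 \<or> y = last p + 1 \<and> c + 1 = y"
    using y by (auto simp: c_def)
  have hy: "hd w \<noteq> y" using yw wne hd_in_set by metis
  \<comment> \<open>\<open>c\<close> is next to \<open>y\<close> but not between \<open>hd w\<close>
    and \<open>y\<close>, so \<open>hd w\<close> and \<open>c\<close> lie on opposite sides of
    \<open>y\<close>.\<close>
  have side: "y = last p + 1 \<longleftrightarrow> y < hd w"
    using adj[OF cw] cy hd hy lastw by linarith
  \<comment> \<open>The gap between \<open>hd w\<close> and \<open>y\<close> extends to
    \<open>c\<close>, because \<open>y\<close> is missing from \<open>w\<close> and \<open>c\<close>
    is next to \<open>y\<close>.\<close>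
  have "ends_adjacent w"
    unfolding ends_adjacent_def lastw
  proof
    fix z assume z: "z \<in> set w"
    then have "z \<noteq> y" using yw by auto
    then show "\<not> (hd w < z \<and> z < c) \<and> \<not> (c < z \<and> z < hd w)"
      using adj[OF z] adj[OF cw] cy by linarith
  qed
  moreover have "uniquely_determined k (pattern_of w)"
    using irreducible_pattern_butlast[OF irt] u(2) order_isomorphic_butlast pattern_of_cong
    unfolding w_def by metis
  ultimately have "\<not> k < length w"
    using not_uniquely_determined_if_ends_adjacent[of w k] du uw k by auto
  then have len: "length w = k" using lw by simp
  have lp: "length p = length r + k" using arg_cong[OF rw, of length] len by simp
  have "hd w = (map ?f p) ! (length p - k)"
    unfolding rw using lp wne by (simp add: nth_append hd_conv_nth)
  then have "hd w = ?f (p ! (length p - k))" using lp k ne by simp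
  then show ?thesis using side y hy by (auto split: if_splits)
qed

theorem theorem7:
  fixes k :: nat
  assumes "k \<ge> 2"
  shows "\<not> (\<exists>p. crucial (irreducible_prohibited k) p)"
proof
  assume "\<exists>p. crucial (irreducible_prohibited k) p"
  then obtain p where p: "p \<noteq> []" "p \<in> perms (length p)"
      "\<And>t. t \<in> irreducible_prohibited k \<Longrightarrow> \<not> contains_pattern p t"
      "\<And>y. y \<in> {1..length p + 1} \<Longrightarrow>
         \<exists>t \<in> irreducible_prohibited k. contains_pattern (adjoin_right y p) t"
    unfolding crucial_def by (metis list.size(3) not_one_le_zero)
  have "last p \<in> {1..length p}"
    using p(1,2) last_in_set[of p] by (auto simp: perms_def permutations_of_set_def)
  then have "\<exists>t \<in> irreducible_prohibited k. contains_pattern (adjoin_right (last p) p) t"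
    and "\<exists>t \<in> irreducible_prohibited k. contains_pattern (adjoin_right (last p + 1) p) t"
    by (auto intro!: p(4))
  then obtain s t where "s \<in> irreducible_prohibited k" "t \<in> irreducible_prohibited k"
    and "contains_pattern (adjoin_right (last p) p) s"
    and "contains_pattern (adjoin_right (last p + 1) p) t"
    by blast
  \<comment> \<open>Both sides are equivalent to the same comparison within
    \<open>p\<close>.\<close>
  then have "last p = last p + 1 \<longleftrightarrow> last p + 1 = last p + 1"
    using adjoin_next_to_last[OF assms perms_distinct[OF p(2)] p(1) _ p(3)] by metis
  then show False by simp
qed

end
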